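(* Let $\omega_1=\frac{-1+i\sqrt3}{2}$ and $\omega_2=\frac{-1-i\sqrt3}{2}$ (with $i$ the complex imaginary unit), and put $\underline{\alpha}=1+2\mathbf{i}+4\mathbf{j}+8\mathbf{k}$ and $\underline{\omega_{r}}=1+\omega_{r}\mathbf{i}+\omega_{r}^{2}\mathbf{j}+\mathbf{k}$ for $r=1,2$. Then for every integer $m\ge 0$, $$JN_{m}^{(3)}=\frac{2}{7}2^{m}\underline{\alpha}-\frac{3+2i\sqrt{3}}{21}\underline{\omega_{1}}\,\omega_{1}^{m}-\frac{3-2i\sqrt{3}}{21}\underline{\omega_{2}}\,\omega_{2}^{m}=\frac{1}{7}\left(2^{m+1}\underline{\alpha}-VN_{m}^{(3)}\right)$$ and $$jN_{m}^{(3)}=\frac{8}{7}2^{m}\underline{\alpha}+\frac{3+2i\sqrt{3}}{7}\underline{\omega_{1}}\,\omega_{1}^{m}+\frac{3-2i\sqrt{3}}{7}\underline{\omega_{2}}\,\omega_{2}^{m}=\frac{1}{7}\left(2^{m+3}\underline{\alpha}+3VN_{m}^{(3)}\right),$$ where $VN_m^{(3)}$ is the sequence defined by $$VN_{m}^{(3)}=\begin{cases}2-3\mathbf{i}+\mathbf{j}+2\mathbf{k} & \text{if } m\equiv 0 \pmod 3,\\ -3+\mathbf{i}+2\mathbf{j}-3\mathbf{k} & \text{if } m\equiv 1 \pmod 3,\\ 1+2\mathbf{i}-3\mathbf{j}+\mathbf{k} & \text{if } m\equiv 2\pmod 3.\end{cases}$$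
   Context: Dual quaternions: the algebra of elements $a+b\mathbf{i}+c\mathbf{j}+d\mathbf{k}$ with real coefficients $a,b,c,d$, with componentwise addition and bilinear multiplication determined by $1$ being the identity and $\mathbf{i}^2=\mathbf{j}^2=\mathbf{k}^2=0$, $\mathbf{ij}=\mathbf{ji}=\mathbf{jk}=\mathbf{kj}=\mathbf{ik}=\mathbf{ki}=0$. In the formulas involving $\omega_1,\omega_2$ one works with complex coefficients $a,b,c,d\in\mathbb{C}$ (same rules); the complex unit $i$ is a scalar and is distinct from the quaternion unit $\mathbf{i}$. The third-order Jacobsthal numbers are defined by $J_0^{(3)}=0$, $J_1^{(3)}=J_2^{(3)}=1$, $J_{n+3}^{(3)}=J_{n+2}^{(3)}+J_{n+1}^{(3)}+2J_n^{(3)}$ for $n\ge 0$. The third-order Jacobsthal-Lucas numbers are defined by $j_0^{(3)}=2$, $j_1^{(3)}=1$, $j_2^{(3)}=5$, $j_{n+3}^{(3)}=j_{n+2}^{(3)}+j_{n+1}^{(3)}+2j_n^{(3)}$ for $n\ge 0$. The superscript $(3)$ is part of the notation, not an exponent. For $m\ge 0$, the dual third-order Jacobsthal quaternions are $JN_m^{(3)}=J_m^{(3)}+J_{m+1}^{(3)}\mathbf{i}+J_{m+2}^{(3)}\mathbf{j}+J_{m+3}^{(3)}\mathbf{k}$ and the dual third-order Jacobsthal-Lucas quaternions are $jN_m^{(3)}=j_m^{(3)}+j_{m+1}^{(3)}\mathbf{i}+j_{m+2}^{(3)}\mathbf{j}+j_{m+3}^{(3)}\mathbf{k}$. *)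

theory Defs
  imports Complex_Main
begin

text \<open>
  Dual quaternions \<open>a + b i + c j + d k\<close> with coefficients in an arbitrary commutative ring;
  the coefficient types of interest are \<^typ>\<open>real\<close> and \<^typ>\<open>complex\<close>. All products of two of
  the units \<open>i\<close>, \<open>j\<close>, \<open>k\<close> vanish.
\<close>

datatype 'a dual_quat = DQ (dq_re: 'a) (dq_i: 'a) (dq_j: 'a) (dq_k: 'a)

instantiation dual_quat :: (comm_ring_1) comm_ring_1
begin

definition zero_dual_quat :: "'a dual_quat" where
  "0 = DQ 0 0 0 0"

definition one_dual_quat :: "'a dual_quat" where
  "1 = DQ 1 0 0 0"

definition plus_dual_quat :: "'a dual_quat \<Rightarrow> 'a dual_quat \<Rightarrow> 'a dual_quat" where
  "p + q = DQ (dq_re p + dq_re q) (dq_i p + dq_i q) (dq_j p + dq_j q) (dq_k p + dq_k q)"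

definition uminus_dual_quat :: "'a dual_quat \<Rightarrow> 'a dual_quat" where
  "- q = DQ (- dq_re q) (- dq_i q) (- dq_j q) (- dq_k q)"

definition minus_dual_quat :: "'a dual_quat \<Rightarrow> 'a dual_quat \<Rightarrow> 'a dual_quat" where
  "p - q = DQ (dq_re p - dq_re q) (dq_i p - dq_i q) (dq_j p - dq_j q) (dq_k p - dq_k q)"

definition times_dual_quat :: "'a dual_quat \<Rightarrow> 'a dual_quat \<Rightarrow> 'a dual_quat" where
  "p * q = DQ (dq_re p * dq_re q)
              (dq_re p * dq_i q + dq_i p * dq_re q)
              (dq_re p * dq_j q + dq_j p * dq_re q)
              (dq_re p * dq_k q + dq_k p * dq_re q)"

instance
  by standard
    (simp_all add: zero_dual_quat_def one_dual_quat_def plus_dual_quat_def uminus_dual_quat_def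
      minus_dual_quat_def times_dual_quat_def algebra_simps dual_quat.expand)

end

definition dq_scale :: "'a::comm_ring_1 \<Rightarrow> 'a dual_quat \<Rightarrow> 'a dual_quat"  (infixr "*\<^sub>D" 75) where
  "c *\<^sub>D q = DQ (c * dq_re q) (c * dq_i q) (c * dq_j q) (c * dq_k q)"

definition unit_i :: "'a::comm_ring_1 dual_quat" where "unit_i = DQ 0 1 0 0"
definition unit_j :: "'a::comm_ring_1 dual_quat" where "unit_j = DQ 0 0 1 0"
definition unit_k :: "'a::comm_ring_1 dual_quat" where "unit_k = DQ 0 0 0 1"

lemma DQ_eq_basis:
  "DQ a b c d = a *\<^sub>D 1 + b *\<^sub>D unit_i + c *\<^sub>D unit_j + d *\<^sub>D unit_k"
  by (simp add: dq_scale_def unit_i_def unit_j_def unit_k_def one_dual_quat_def plus_dual_quat_def)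

lemma unit_products:
  assumes "p \<in> {unit_i, unit_j, unit_k}" and "q \<in> {unit_i, unit_j, unit_k}"
  shows "p * q = 0"
  using assms
  by (auto simp: unit_i_def unit_j_def unit_k_def times_dual_quat_def zero_dual_quat_def)

lemma dq_scale_mult_left: "(c *\<^sub>D p) * q = c *\<^sub>D (p * q)"
  by (simp add: dq_scale_def times_dual_quat_def algebra_simps)

lemma dq_scale_mult_right: "p * (c *\<^sub>D q) = c *\<^sub>D (p * q)"
  by (simp add: dq_scale_def times_dual_quat_def algebra_simps)

text \<open>The inclusion of the real dual quaternions into the complex ones.\<close>

definition dq_complex :: "real dual_quat \<Rightarrow> complex dual_quat" where
  "dq_complex q = map_dual_quat complex_of_real q"

fun jacobsthal3 :: "nat \<Rightarrow> nat" where
  "jacobsthal3 0 = 0"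
| "jacobsthal3 (Suc 0) = 1"
| "jacobsthal3 (Suc (Suc 0)) = 1"
| "jacobsthal3 (Suc (Suc (Suc n))) =
     jacobsthal3 (Suc (Suc n)) + jacobsthal3 (Suc n) + 2 * jacobsthal3 n"

fun jacobsthal_lucas3 :: "nat \<Rightarrow> nat" where
  "jacobsthal_lucas3 0 = 2"
| "jacobsthal_lucas3 (Suc 0) = 1"
| "jacobsthal_lucas3 (Suc (Suc 0)) = 5"
| "jacobsthal_lucas3 (Suc (Suc (Suc n))) =
     jacobsthal_lucas3 (Suc (Suc n)) + jacobsthal_lucas3 (Suc n) + 2 * jacobsthal_lucas3 n"

definition JN :: "nat \<Rightarrow> real dual_quat" where
  "JN m = DQ (real (jacobsthal3 m)) (real (jacobsthal3 (m + 1)))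
             (real (jacobsthal3 (m + 2))) (real (jacobsthal3 (m + 3)))"

definition jN :: "nat \<Rightarrow> real dual_quat" where
  "jN m = DQ (real (jacobsthal_lucas3 m)) (real (jacobsthal_lucas3 (m + 1)))
             (real (jacobsthal_lucas3 (m + 2))) (real (jacobsthal_lucas3 (m + 3)))"

definition VN :: "nat \<Rightarrow> real dual_quat" where
  "VN m = (if m mod 3 = 0 then DQ 2 (-3) 1 2
           else if m mod 3 = 1 then DQ (-3) 1 2 (-3)
           else DQ 1 2 (-3) 1)"

definition omega1 :: complex where
  "omega1 = (-1 + \<i> * complex_of_real (sqrt 3)) / 2"

definition omega2 :: complex where
  "omega2 = (-1 - \<i> * complex_of_real (sqrt 3)) / 2"

definition alpha_bar :: "real dual_quat" where
  "alpha_bar = DQ 1 2 4 8"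

text \<open>The last coefficient is \<open>1 = w ^ 3\<close> for \<open>w = omega1\<close> and \<open>w = omega2\<close>.\<close>

definition omega_bar :: "complex \<Rightarrow> complex dual_quat" where
  "omega_bar w = DQ 1 w (w ^ 2) 1"

end

theory Submission
  imports Defs
begin

text \<open>
  The characteristic polynomial of both recurrences is \<open>(x - 2) (x\<^sup>2 + x + 1)\<close>, with roots \<open>2\<close>,
  \<open>omega1\<close>, \<open>omega2\<close>. Hence each sequence is a multiple of \<open>2 ^ n\<close> plus a part of period 3 with
  vanishing sum over a period, and this part is a combination of the powers of the two primitive
  cube roots of unity. The quaternion identities are the scalar ones read off in each coefficient.
\<close>

text \<open>The periodic part shared by both sequences: it enters \<open>jacobsthal3\<close> with
  factor -1/7 and \<open>jacobsthal_lucas3\<close> with factor 3/7.\<close>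

definition VN_scalar :: "nat \<Rightarrow> real" where
  "VN_scalar n = (if n mod 3 = 0 then 2 else if n mod 3 = 1 then -3 else 1)"

lemma VN_scalar_init [simp]: "VN_scalar 0 = 2" "VN_scalar (Suc 0) = -3" "VN_scalar (Suc (Suc 0)) = 1"
  by (simp_all add: VN_scalar_def)

lemma VN_scalar_add_3 [simp]: "VN_scalar (Suc (Suc (Suc n))) = VN_scalar n"
proof -
  have "Suc (Suc (Suc n)) mod 3 = n mod 3"
    by presburger
  then show ?thesis
    by (simp add: VN_scalar_def)
qed

text \<open>Together with period 3 this yields the Jacobsthal recurrence for
  \<open>VN_scalar\<close>: adding v(n) to the vanishing sum gives v(n+3) = v(n) = v(n+2) + v(n+1) +
  2 v(n).\<close>

lemma VN_scalar_sum_period: "VN_scalar n + VN_scalar (Suc n) + VN_scalar (Suc (Suc n)) = 0"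
  by (induction n rule: jacobsthal3.induct) simp_all

lemma VN_eq_scalar: "VN m = DQ (VN_scalar m) (VN_scalar (m + 1)) (VN_scalar (m + 2)) (VN_scalar (m + 3))"
proof -
  consider "m mod 3 = 0" | "m mod 3 = 1" | "m mod 3 = 2"
    by linarith
  then show ?thesis
    by cases (simp_all add: VN_def VN_scalar_def mod_Suc numeral_2_eq_2)
qed

text \<open>Both sides obey the same recurrence, the powers of 2 because 8 = 4 + 2 + 2, and they
  agree at 0, 1, 2.\<close>

lemma jacobsthal3_closed_form: "real (jacobsthal3 n) = (2 ^ (n + 1) - VN_scalar n) / 7"
proof (induction n rule: jacobsthal3.induct)
  case (4 n)
  then show ?case
    using VN_scalar_sum_period [of n] by (simp add: field_simps)
qed simp_all

lemma jacobsthal_lucas3_closed_form: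
  "real (jacobsthal_lucas3 n) = (2 ^ (n + 3) + 3 * VN_scalar n) / 7"
proof (induction n rule: jacobsthal_lucas3.induct)
  case (4 n)
  then show ?case
    using VN_scalar_sum_period [of n] by (simp add: field_simps power_add)
qed simp_all

lemma of_real_sqrt_3_mult_self: "complex_of_real (sqrt 3) * complex_of_real (sqrt 3) = 3"
  by (simp flip: of_real_mult)

lemma omega_squared: "omega1 ^ 2 = omega2" "omega2 ^ 2 = omega1"
  using of_real_sqrt_3_mult_self
  by (simp_all add: omega1_def omega2_def power2_eq_square field_simps complex_eq_iff)

text \<open>Squaring swaps the two roots, so each cube is the product of the roots, which is
  1.\<close>

lemma omega_cubed: "omega1 ^ 3 = 1" "omega2 ^ 3 = 1"
proof -
  have "omega1 * omega2 = 1"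
    using of_real_sqrt_3_mult_self
    by (simp add: omega1_def omega2_def field_simps complex_eq_iff)
  then show "omega1 ^ 3 = 1" "omega2 ^ 3 = 1"
    using omega_squared by (simp_all add: power3_eq_cube power2_eq_square mult.commute)
qed

text \<open>The coefficients A, B of the two powers solve A + B = 2 and A \<open>omega1\<close> + B
  \<open>omega2\<close> = -3, the values at 0 and 1.\<close>

lemma VN_scalar_eq_omega_powers:
  "complex_of_real (VN_scalar n) =
     ((3 + 2 * \<i> * complex_of_real (sqrt 3)) * omega1 ^ n
      + (3 - 2 * \<i> * complex_of_real (sqrt 3)) * omega2 ^ n) / 3"
proof (induction n rule: jacobsthal3.induct)
  case 1
  show ?case
    by simp
next
  case 2
  show ?case
    using of_real_sqrt_3_mult_self
    by (simp add: omega1_def omega2_def field_simps complex_eq_iff)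
next
  case 3
  have "omega1 ^ Suc (Suc 0) = omega2" "omega2 ^ Suc (Suc 0) = omega1"
    using omega_squared by (simp_all add: numeral_2_eq_2)
  \<comment> \<open>Three times the value 1 at index 2; the roots appear interchanged because they
    have been squared.\<close>
  moreover have "3 = (3 + 2 * \<i> * complex_of_real (sqrt 3)) * omega2
      + (3 - 2 * \<i> * complex_of_real (sqrt 3)) * omega1"
    using of_real_sqrt_3_mult_self
    by (simp add: omega1_def omega2_def field_simps complex_eq_iff)
  ultimately show ?case
    by (simp del: power_Suc)
next
  case (4 n)
  \<comment> \<open>Both sides have period 3, so the hypothesis at \<open>n\<close>
    suffices.\<close>
  have "omega1 ^ Suc (Suc (Suc n)) = omega1 ^ n" "omega2 ^ Suc (Suc (Suc n)) = omega2 ^ n"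
    using omega_cubed by (simp_all add: power3_eq_cube flip: mult.assoc)
  then show ?case
    using 4 by (simp del: power_Suc)
qed

text \<open>In each coefficient w^(m+r) = w^m w^r, so w^m factors out and leaves the entries of
  \<open>omega_bar\<close>; for r = 3 the remaining factor is 1.\<close>

lemma dq_complex_VN:
  "dq_complex (VN m) =
     ((3 + 2 * \<i> * complex_of_real (sqrt 3)) / 3) *\<^sub>D (omega1 ^ m) *\<^sub>D omega_bar omega1
     + ((3 - 2 * \<i> * complex_of_real (sqrt 3)) / 3) *\<^sub>D (omega2 ^ m) *\<^sub>D omega_bar omega2"
  by (simp add: dq_complex_def VN_eq_scalar VN_scalar_eq_omega_powers omega_bar_def dq_scale_def
      plus_dual_quat_def power_add omega_cubed power_Suc2 add_divide_distrib [of "_ * _"]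
      del: VN_scalar_add_3 add_2_eq_Suc' power_Suc)

text \<open>The entries 1, 2, 4, 8 of \<open>alpha_bar\<close> absorb the index shifts in the power
  of 2.\<close>

lemma JN_eq_VN: "JN m = (1 / 7) *\<^sub>D (2 ^ (m + 1) *\<^sub>D alpha_bar - VN m)"
  by (simp add: JN_def jacobsthal3_closed_form VN_eq_scalar alpha_bar_def dq_scale_def
      minus_dual_quat_def power_add del: jacobsthal3.simps)

lemma jN_eq_VN: "jN m = (1 / 7) *\<^sub>D (2 ^ (m + 3) *\<^sub>D alpha_bar + 3 *\<^sub>D VN m)"
  by (simp add: jN_def jacobsthal_lucas3_closed_form VN_eq_scalar alpha_bar_def dq_scale_def
      plus_dual_quat_def power_add del: jacobsthal_lucas3.simps)

lemma dq_complex_plus: "dq_complex (p + q) = dq_complex p + dq_complex q"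
  by (simp add: dq_complex_def plus_dual_quat_def dual_quat.map_sel)

lemma dq_complex_minus: "dq_complex (p - q) = dq_complex p - dq_complex q"
  by (simp add: dq_complex_def minus_dual_quat_def dual_quat.map_sel)

lemma dq_complex_scale: "dq_complex (c *\<^sub>D q) = complex_of_real c *\<^sub>D dq_complex q"
  by (simp add: dq_complex_def dq_scale_def dual_quat.map_sel)

lemma dq_scale_add: "c *\<^sub>D (p + q) = c *\<^sub>D p + c *\<^sub>D q"
  by (simp add: dq_scale_def plus_dual_quat_def distrib_left)

lemma dq_scale_diff: "c *\<^sub>D (p - q) = c *\<^sub>D p - c *\<^sub>D q"
  by (simp add: dq_scale_def minus_dual_quat_def right_diff_distrib)

lemma dq_scale_scale: "c *\<^sub>D d *\<^sub>D q = (c * d) *\<^sub>D q"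
  by (simp add: dq_scale_def mult.assoc)

theorem theorem2p5:
  fixes m :: nat
  shows
    "dq_complex (JN m) =
       (2 / 7 * 2 ^ m) *\<^sub>D dq_complex alpha_bar
       - ((3 + 2 * \<i> * complex_of_real (sqrt 3)) / 21) *\<^sub>D (omega1 ^ m) *\<^sub>D omega_bar omega1
       - ((3 - 2 * \<i> * complex_of_real (sqrt 3)) / 21) *\<^sub>D (omega2 ^ m) *\<^sub>D omega_bar omega2
     \<and> JN m = (1 / 7) *\<^sub>D (2 ^ (m + 1) *\<^sub>D alpha_bar - VN m)
     \<and> dq_complex (jN m) =
       (8 / 7 * 2 ^ m) *\<^sub>D dq_complex alpha_bar
       + ((3 + 2 * \<i> * complex_of_real (sqrt 3)) / 7) *\<^sub>D (omega1 ^ m) *\<^sub>D omega_bar omega1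
       + ((3 - 2 * \<i> * complex_of_real (sqrt 3)) / 7) *\<^sub>D (omega2 ^ m) *\<^sub>D omega_bar omega2
     \<and> jN m = (1 / 7) *\<^sub>D (2 ^ (m + 3) *\<^sub>D alpha_bar + 3 *\<^sub>D VN m)"
proof (intro conjI)
  \<comment> \<open>The complex forms come from the \<open>VN\<close> forms by linearity of
    \<open>dq_complex\<close>; the denominator 3 in \<open>dq_complex_VN\<close> turns the factors
    1/7 and 3/7 into 1/21 and 1/7.\<close>
  note linear = dq_complex_plus dq_complex_minus dq_complex_scale dq_complex_VN
    dq_scale_add dq_scale_diff dq_scale_scale
  show "dq_complex (JN m) =
       (2 / 7 * 2 ^ m) *\<^sub>D dq_complex alpha_bar
       - ((3 + 2 * \<i> * complex_of_real (sqrt 3)) / 21) *\<^sub>D (omega1 ^ m) *\<^sub>D omega_bar omega1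
       - ((3 - 2 * \<i> * complex_of_real (sqrt 3)) / 21) *\<^sub>D (omega2 ^ m) *\<^sub>D omega_bar omega2"
    by (simp add: JN_eq_VN linear diff_diff_eq)
  show "dq_complex (jN m) =
       (8 / 7 * 2 ^ m) *\<^sub>D dq_complex alpha_bar
       + ((3 + 2 * \<i> * complex_of_real (sqrt 3)) / 7) *\<^sub>D (omega1 ^ m) *\<^sub>D omega_bar omega1
       + ((3 - 2 * \<i> * complex_of_real (sqrt 3)) / 7) *\<^sub>D (omega2 ^ m) *\<^sub>D omega_bar omega2"
    by (simp add: jN_eq_VN linear power_add add.assoc mult.commute)
qed (rule JN_eq_VN jN_eq_VN)+

end
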